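(* Let $G$ and $H$ be graphs of orders $m\ge 2$ and $n\ge 2$, respectively, and let $G+H$ denote their join. Then $\gamma_{ds}(G+H)=4$ if and only if both of the following conditions hold: (1) $\gamma_{ds}(G)\ge 4$ and $\gamma_{ds}(H)\ge 4$; (2) $\Delta(G)\le m-3$ and $\Delta(H)\le n-3$.
   Context: All graphs are finite, simple and undirected; $\Delta(G)$ denotes the maximum degree of $G$, and the order of a graph is its number of vertices. A set $S\subseteq V(G)$ is a dual-server dominating set (DS-dominating set) of a graph $G$ if there is a partition $\{R,B\}$ of $S$ such that every vertex of $V(G)\setminus S$ has at least one neighbour in $R$ and at least one neighbour in $B$. The dual-server domination number $\gamma_{ds}(G)$ is the minimum cardinality of a DS-dominating set of $G$. The join $G+H$ is the graph obtained from the disjoint union $G\cup H$ by adding all edges joining every vertex of $G$ to every vertex of $H$. *)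

theory Defs
  imports "HOL-Library.Disjoint_Sets" "Graph_Theory.Pair_Digraph"
begin

text \<open>
  A finite simple undirected graph is a \<^locale>\<open>pair_graph\<close>: a finite, loop-free, symmetric
  digraph without parallel arcs, where an edge joining u and v is the pair of arcs (u, v) and
  (v, u). Hence the degree of a vertex is its out-degree.
\<close>

definition graph_order :: "'a pair_pre_digraph \<Rightarrow> nat" where
  "graph_order G = card (pverts G)"

text \<open>Only meaningful for graphs with at least one vertex.\<close>

definition max_degree :: "'a pair_pre_digraph \<Rightarrow> nat" where
  "max_degree G = Max (out_degree (with_proj G) ` pverts G)"

text \<open>
  The blocks of a partition are nonempty, so R and B are nonempty. Allowing an empty block would
  make a difference only for graphs with at most one vertex: if S is not the whole vertex set, then
  R and B are nonempty by the domination condition, and if it is, then that condition is void and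
  any two-block partition of S will do.
\<close>

definition ds_dominating :: "'a pair_pre_digraph \<Rightarrow> 'a set \<Rightarrow> bool" where
  "ds_dominating G S \<longleftrightarrow> S \<subseteq> pverts G \<and>
     (\<exists>R B. R \<noteq> B \<and> partition_on S {R, B} \<and>
       (\<forall>v \<in> pverts G - S. (\<exists>r \<in> R. v \<rightarrow>\<^bsub>with_proj G\<^esub> r) \<and> (\<exists>b \<in> B. v \<rightarrow>\<^bsub>with_proj G\<^esub> b)))"

definition ds_number :: "'a pair_pre_digraph \<Rightarrow> nat" where
  "ds_number G = (LEAST k. \<exists>S. ds_dominating G S \<and> card S = k)"

definition graph_join ::
    "'a pair_pre_digraph \<Rightarrow> 'b pair_pre_digraph \<Rightarrow> ('a + 'b) pair_pre_digraph" where
  "graph_join G H = \<lparr>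
     pverts = pverts G <+> pverts H,
     parcs = map_prod Inl Inl ` parcs G \<union> map_prod Inr Inr ` parcs H
       \<union> (Inl ` pverts G) \<times> (Inr ` pverts H) \<union> (Inr ` pverts H) \<times> (Inl ` pverts G)\<rparr>"

lemma pair_graph_graph_join:
  assumes "pair_graph G" "pair_graph H"
  shows "pair_graph (graph_join G H)"
proof -
  interpret G: pair_graph G by fact
  interpret H: pair_graph H by fact
  let ?J = "graph_join G H"
  have wf: "fst e \<in> pverts ?J \<and> snd e \<in> pverts ?J" if "e \<in> parcs ?J" for e
    using that unfolding graph_join_def
    by (auto dest: G.in_arcsD1 G.in_arcsD2 H.in_arcsD1 H.in_arcsD2)
  have loopfree: "fst e \<noteq> snd e" if "e \<in> parcs ?J" for e
    using that unfolding graph_join_def by (auto dest: G.no_loops' H.no_loops')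
  have fin_v: "finite (pverts ?J)"
    using G.pair_finite_verts H.pair_finite_verts by (simp add: graph_join_def)
  have fin_a: "finite (parcs ?J)"
    using G.pair_finite_verts H.pair_finite_verts G.pair_finite_arcs H.pair_finite_arcs
    by (simp add: graph_join_def)
  have "(v, u) \<in> parcs ?J" if "(u, v) \<in> parcs ?J" for u v
    using that unfolding graph_join_def
    by (cases u; cases v)
      (auto simp: image_iff Bex_def dest: G.arcs_symmetric H.arcs_symmetric)
  then have sym: "symmetric (with_proj ?J)"
    unfolding symmetric_def sym_def with_proj_simps by blast
  show ?thesis
    using wf loopfree fin_v fin_a sym
    unfolding pair_graph_def pair_digraph_def pair_pseudo_graph_def pair_fin_digraph_def
      pair_fin_digraph_axioms_def pair_sym_digraph_def pair_sym_digraph_axioms_def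
      pair_loopfree_digraph_def pair_loopfree_digraph_axioms_def pair_wf_digraph_def
    by blast
qed

lemma ds_dominating_pverts:
  assumes "graph_order G \<ge> 2"
  shows "ds_dominating G (pverts G)"
proof -
  have card: "card (pverts G) \<ge> 2"
    using assms by (simp only: graph_order_def)
  then have "pverts G \<noteq> {}"
    by (metis card.empty not_numeral_le_zero)
  then obtain x where x: "x \<in> pverts G"
    by (metis ex_in_conv)
  have ne: "pverts G - {x} \<noteq> {}"
  proof
    assume "pverts G - {x} = {}"
    then have "pverts G = {x}"
      using x by blast
    with card show False
      by simp
  qed
  have part: "partition_on (pverts G) {{x}, pverts G - {x}}"
    using x ne by (auto simp: partition_on_def disjoint_def)
  have diff: "{x} \<noteq> pverts G - {x}"
    by blast
  show ?thesis
    unfolding ds_dominating_def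
    by (rule conjI[OF order_refl], rule exI[of _ "{x}"], rule exI[of _ "pverts G - {x}"],
        rule conjI[OF diff], rule conjI[OF part], rule ballI, simp only: Diff_cancel empty_iff)
qed

end

theory Submission
  imports Defs
begin

text \<open>
  Two vertices of G and two of H, one of each placed in R and one of each in B, always form a
  DS-dominating set of the join, so \<open>\<gamma>\<^sub>d\<^sub>s(G + H) \<le> 4\<close> and the theorem amounts to a description of
  the joins that have a DS-dominating set with at most three vertices
  (\<open>ds_number_join_le_3_iff\<close>).

  There are two ways of obtaining such a set. Since every vertex of H is adjacent to every
  vertex of G, a DS-dominating set of G is one of \<open>G + H\<close>. And if a vertex v of G is adjacent to
  all other vertices of G except possibly one vertex w, then \<open>R = {v}\<close> and \<open>B = {w, h}\<close> work for
  any vertex h of H: the remaining vertices of G see v and h, those of H see v and w. Such v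
  and w exist exactly when \<open>\<Delta>(G) \<ge> m - 2\<close> (\<open>max_degree_ge_order_minus_2_iff\<close>).

  Conversely, let S be a DS-dominating set of the join with \<open>|S| \<le> 3\<close>. If S lies in one of the
  two sides, it is a DS-dominating set of that side. Otherwise one of its blocks is a singleton
  \<open>{x}\<close>, say with x in G. As S also meets H, it contains at most one vertex w of G besides x, and
  every vertex of G outside S must be adjacent to x; so \<open>\<Delta>(G) \<ge> m - 2\<close>.
\<close>

section \<open>DS-domination and maximum degree in terms of arcs\<close>

lemma ds_dominating_iff:
  "ds_dominating G S \<longleftrightarrow> S \<subseteq> pverts G \<and>
     (\<exists>R B. R \<noteq> {} \<and> B \<noteq> {} \<and> R \<inter> B = {} \<and> R \<union> B = S \<and>
       (\<forall>v \<in> pverts G - S. (\<exists>r \<in> R. (v, r) \<in> parcs G) \<and> (\<exists>b \<in> B. (v, b) \<in> parcs G)))"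
proof -
  have "R \<noteq> B \<and> partition_on S {R, B} \<and> P \<longleftrightarrow>
      R \<noteq> {} \<and> B \<noteq> {} \<and> R \<inter> B = {} \<and> R \<union> B = S \<and> P" for R B :: "'a set" and P
    unfolding partition_on_def disjoint_def by blast
  then show ?thesis
    by (simp only: ds_dominating_def with_proj_simps)
qed

lemma ds_dominatingI:
  assumes "R \<union> B = S" and "R \<noteq> {}" and "B \<noteq> {}" and "R \<inter> B = {}" and "S \<subseteq> pverts G"
    and "\<And>v. v \<in> pverts G - S \<Longrightarrow> (\<exists>r \<in> R. (v, r) \<in> parcs G) \<and> (\<exists>b \<in> B. (v, b) \<in> parcs G)"
  shows "ds_dominating G S"
  unfolding ds_dominating_iff
  by (rule conjI, fact, rule exI[of _ R], rule exI[of _ B], intro conjI ballI assms)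

lemma ds_number_le_iff:
  assumes "graph_order G \<ge> 2"
  shows "ds_number G \<le> k \<longleftrightarrow> (\<exists>S. ds_dominating G S \<and> card S \<le> k)"
proof
  have "\<exists>S. ds_dominating G S \<and> card S = card (pverts G)"
    using ds_dominating_pverts[OF assms] by blast
  then have "\<exists>S. ds_dominating G S \<and> card S = ds_number G"
    unfolding ds_number_def by (rule LeastI)
  then show "ds_number G \<le> k \<Longrightarrow> \<exists>S. ds_dominating G S \<and> card S \<le> k"
    by auto
next
  assume "\<exists>S. ds_dominating G S \<and> card S \<le> k"
  then obtain S where "ds_dominating G S" "card S \<le> k"
    by blast
  then show "ds_number G \<le> k"
    unfolding ds_number_def by (metis (mono_tags, lifting) Least_le order_trans)
qed

lemma (in pair_graph) out_degree_eq_card_neighbours: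
  "out_degree (with_proj G) v = card {u. (u, v) \<in> parcs G}"
proof -
  have "out_arcs (with_proj G) v = Pair v ` {u. (u, v) \<in> parcs G}"
    by (auto simp: out_arcs_def dest: arcs_symmetric)
  then show ?thesis
    by (simp add: out_degree_def card_image inj_on_def)
qed

lemma max_degree_ge_order_minus_2_iff:
  assumes "pair_graph G" and "graph_order G \<ge> 2"
  shows "graph_order G \<le> max_degree G + 2 \<longleftrightarrow>
    (\<exists>v \<in> pverts G. \<exists>w \<in> pverts G. v \<noteq> w \<and> (\<forall>u \<in> pverts G - {v, w}. (u, v) \<in> parcs G))"
proof -
  interpret pair_graph G by fact
  let ?V = "pverts G" and ?N = "\<lambda>v. {u. (u, v) \<in> parcs G}"
  have card_V: "card ?V \<ge> 2"
    using assms(2) by (simp add: graph_order_def)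
  have N: "?N v \<subseteq> ?V - {v}" for v
    by (auto dest: in_arcsD1 no_loops')
  have "?V \<noteq> {}"
    using card_V by auto
  then have "card ?V - 2 \<le> max_degree G \<longleftrightarrow> (\<exists>v \<in> ?V. card ?V - 2 \<le> card (?N v))"
    unfolding max_degree_def out_degree_eq_card_neighbours by (subst Max_ge_iff) auto
  then have "graph_order G \<le> max_degree G + 2 \<longleftrightarrow>
      (\<exists>v \<in> ?V. card ?V - 2 \<le> card (?N v))"
    by (simp only: graph_order_def le_diff_conv)
  moreover have "card ?V - 2 \<le> card (?N v) \<longleftrightarrow>
      (\<exists>w \<in> ?V. v \<noteq> w \<and> (\<forall>u \<in> ?V - {v, w}. (u, v) \<in> parcs G))" if v: "v \<in> ?V" for v
  proof
    assume le: "card ?V - 2 \<le> card (?N v)"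
    let ?M = "?V - {v} - ?N v"
    have fin: "finite (?N v)"
      using N[of v] by (rule finite_subset) simp
    have "card ?M = card ?V - 1 - card (?N v)"
      using v by (simp add: card_Diff_subset[OF fin N])
    with le have "card ?M \<le> 1"
      by linarith
    then have M: "x = y" if "x \<in> ?M" "y \<in> ?M" for x y
      using that by (auto simp: card_le_Suc0_iff_eq)
    have "?V \<noteq> {v}"
      using card_V by auto
    \<comment> \<open>If v is adjacent to all other vertices, any of them can serve as w.\<close>
    with v obtain w where "w \<in> ?V" "v \<noteq> w" "?M = {} \<or> w \<in> ?M"
      by (cases "?M = {}") auto
    with M show "\<exists>w \<in> ?V. v \<noteq> w \<and> (\<forall>u \<in> ?V - {v, w}. (u, v) \<in> parcs G)"
      by blast
  next
    assume "\<exists>w \<in> ?V. v \<noteq> w \<and> (\<forall>u \<in> ?V - {v, w}. (u, v) \<in> parcs G)"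
    then obtain w where w: "w \<in> ?V" "v \<noteq> w" "?V - {v, w} \<subseteq> ?N v"
      by blast
    have "finite (?N v)"
      using N[of v] by (rule finite_subset) simp
    from card_mono[OF this w(3)] show "card ?V - 2 \<le> card (?N v)"
      using v w by (simp add: card_Diff_subset)
  qed
  ultimately show ?thesis
    by blast
qed

section \<open>DS-domination in joins\<close>

lemma pverts_join [simp]: "pverts (graph_join G H) = pverts G <+> pverts H"
  by (simp add: graph_join_def)

lemma parcs_join_iff [simp]:
  "(Inl u, Inl v) \<in> parcs (graph_join G H) \<longleftrightarrow> (u, v) \<in> parcs G"
  "(Inr x, Inr y) \<in> parcs (graph_join G H) \<longleftrightarrow> (x, y) \<in> parcs H"
  "(Inl u, Inr x) \<in> parcs (graph_join G H) \<longleftrightarrow> u \<in> pverts G \<and> x \<in> pverts H"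
  "(Inr x, Inl u) \<in> parcs (graph_join G H) \<longleftrightarrow> u \<in> pverts G \<and> x \<in> pverts H"
  by (auto simp: graph_join_def)

lemma graph_order_join:
  assumes "pair_graph G" and "pair_graph H"
  shows "graph_order (graph_join G H) = graph_order G + graph_order H"
proof -
  interpret G: pair_graph G by fact
  interpret H: pair_graph H by fact
  show ?thesis
    by (simp add: graph_order_def card_Plus)
qed

text \<open>The join is commutative up to the swap of the two summands.\<close>

lemma ds_dominating_join_swap:
  assumes "ds_dominating (graph_join G H) S"
  shows "ds_dominating (graph_join H G) (case_sum Inr Inl ` S)"
proof -
  let ?\<sigma> = "case_sum Inr Inl :: 'a + 'b \<Rightarrow> 'b + 'a"
  let ?J = "graph_join G H" and ?K = "graph_join H G"
  obtain R B where S: "S \<subseteq> pverts ?J"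
    and RB: "R \<noteq> {}" "B \<noteq> {}" "R \<inter> B = {}" "R \<union> B = S"
    and dom: "\<forall>v \<in> pverts ?J - S.
      (\<exists>r \<in> R. (v, r) \<in> parcs ?J) \<and> (\<exists>b \<in> B. (v, b) \<in> parcs ?J)"
    using assms unfolding ds_dominating_iff by blast
  have inj: "inj ?\<sigma>"
    by (auto simp: inj_def split: sum.splits)
  have arcs: "(?\<sigma> x, ?\<sigma> y) \<in> parcs ?K \<longleftrightarrow> (x, y) \<in> parcs ?J" for x y
    by (auto split: sum.split)
  have verts: "pverts ?K = ?\<sigma> ` pverts ?J"
    by (force simp: Plus_def image_Un image_image)
  have "(\<exists>r \<in> ?\<sigma> ` R. (v, r) \<in> parcs ?K) \<and> (\<exists>b \<in> ?\<sigma> ` B. (v, b) \<in> parcs ?K)"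
    if "v \<in> pverts ?K - ?\<sigma> ` S" for v
  proof -
    have "v \<in> ?\<sigma> ` (pverts ?J - S)"
      using that by (simp only: verts image_set_diff[OF inj])
    then obtain u where "v = ?\<sigma> u" "u \<in> pverts ?J - S"
      by (rule imageE)
    with bspec[OF dom, of u] show ?thesis
      by (simp add: arcs)
  qed
  moreover have "?\<sigma> ` S \<subseteq> pverts ?K"
    using S unfolding verts by (rule image_mono)
  moreover have "?\<sigma> ` R \<inter> ?\<sigma> ` B = {}"
    using RB(3) by (simp flip: image_Int[OF inj])
  moreover have "?\<sigma> ` R \<union> ?\<sigma> ` B = ?\<sigma> ` S" "?\<sigma> ` R \<noteq> {}" "?\<sigma> ` B \<noteq> {}"
    using RB by (simp_all flip: image_Un)
  ultimately show ?thesis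
    by (intro ds_dominatingI[of "?\<sigma> ` R" "?\<sigma> ` B"])
qed

lemma ds_number_join_commute:
  "ds_number (graph_join G H) = ds_number (graph_join H G)"
proof -
  have card: "card (case_sum Inr Inl ` S :: ('d + 'c) set) = card S" for S :: "('c + 'd) set"
    by (rule card_image) (auto simp: inj_on_def split: sum.splits)
  have "(\<exists>S. ds_dominating (graph_join G H) S \<and> card S = k) \<longleftrightarrow>
      (\<exists>S. ds_dominating (graph_join H G) S \<and> card S = k)" for k
    using ds_dominating_join_swap card by metis
  then show ?thesis
    by (simp add: ds_number_def)
qed

lemma ds_number_join_le_4:
  assumes "pair_graph G" and "pair_graph H"
    and "graph_order G \<ge> 2" and "graph_order H \<ge> 2"
  shows "ds_number (graph_join G H) \<le> 4"
proof -
  have two: "\<exists>x \<in> A. \<exists>y \<in> A. x \<noteq> y" if "card A \<ge> 2" for A :: "'c set"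
  proof (rule ccontr)
    assume "\<not> ?thesis"
    moreover have "finite A"
      using that by (intro card_ge_0_finite) simp
    ultimately have "card A \<le> Suc 0"
      by (subst card_le_Suc0_iff_eq) auto
    with that show False
      by simp
  qed
  obtain g g' where g: "g \<in> pverts G" "g' \<in> pverts G" "g \<noteq> g'"
    using two assms(3) unfolding graph_order_def by blast
  obtain h h' where h: "h \<in> pverts H" "h' \<in> pverts H" "h \<noteq> h'"
    using two assms(4) unfolding graph_order_def by blast
  let ?S = "{Inl g, Inr h, Inl g', Inr h'}"
  have "ds_dominating (graph_join G H) ?S"
    using g h by (intro ds_dominatingI[of "{Inl g, Inr h}" "{Inl g', Inr h'}"]) auto
  moreover have "card ?S = 4"
    using g h by simp
  ultimately show ?thesis
    using assms by (subst ds_number_le_iff) (auto simp: graph_order_join)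
qed

section \<open>Joins with a small DS-dominating set\<close>

lemma ds_dominating_join_Inl:
  assumes "ds_dominating G S"
  shows "ds_dominating (graph_join G H) (Inl ` S)"
proof -
  obtain R B where S: "S \<subseteq> pverts G"
    and RB: "R \<noteq> {}" "B \<noteq> {}" "R \<inter> B = {}" "R \<union> B = S"
    and dom: "\<forall>v \<in> pverts G - S. (\<exists>r \<in> R. (v, r) \<in> parcs G) \<and> (\<exists>b \<in> B. (v, b) \<in> parcs G)"
    using assms unfolding ds_dominating_iff by blast
  show ?thesis
  proof (rule ds_dominatingI[of "Inl ` R" "Inl ` B"])
    fix v
    assume v: "v \<in> pverts (graph_join G H) - Inl ` S"
    show "(\<exists>r \<in> Inl ` R. (v, r) \<in> parcs (graph_join G H)) \<and>
      (\<exists>b \<in> Inl ` B. (v, b) \<in> parcs (graph_join G H))"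
    proof (cases v)
      case (Inl u)
      with v have "u \<in> pverts G - S"
        by auto
      with dom Inl show ?thesis
        by simp
    next
      case (Inr u)
      with v S RB show ?thesis
        by fastforce
    qed
  qed (use S RB in auto)
qed

lemma ds_dominating_of_join_Inl:
  assumes "ds_dominating (graph_join G H) S" and "S \<subseteq> Inl ` pverts G"
  shows "ds_dominating G (Inl -` S)"
proof -
  obtain R B where RB: "R \<noteq> {}" "B \<noteq> {}" "R \<inter> B = {}" "R \<union> B = S"
    and dom: "\<forall>v \<in> pverts (graph_join G H) - S. (\<exists>r \<in> R. (v, r) \<in> parcs (graph_join G H)) \<and>
      (\<exists>b \<in> B. (v, b) \<in> parcs (graph_join G H))"
    using assms(1) unfolding ds_dominating_iff by blast
  have sub: "R \<subseteq> Inl ` pverts G" "B \<subseteq> Inl ` pverts G"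
    using RB(4) assms(2) by auto
  have "(\<exists>r \<in> Inl -` R. (v, r) \<in> parcs G) \<and> (\<exists>b \<in> Inl -` B. (v, b) \<in> parcs G)"
    if "v \<in> pverts G - Inl -` S" for v
  proof -
    have "Inl v \<in> pverts (graph_join G H) - S"
      using that by auto
    from bspec[OF dom this] obtain r b where "r \<in> R" "(Inl v, r) \<in> parcs (graph_join G H)"
      and "b \<in> B" "(Inl v, b) \<in> parcs (graph_join G H)"
      by blast
    moreover from this sub obtain r' b' where "r = Inl r'" "b = Inl b'"
      by blast
    ultimately show ?thesis
      by auto
  qed
  moreover have "Inl -` R \<noteq> {}" "Inl -` B \<noteq> {}" "Inl -` R \<union> Inl -` B = Inl -` S"
      "Inl -` R \<inter> Inl -` B = {}" "Inl -` S \<subseteq> pverts G"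
    using RB sub assms(2) by blast+
  ultimately show ?thesis
    by (intro ds_dominatingI[of "Inl -` R" "Inl -` B"])
qed

lemma ds_number_le_of_join_Inl:
  assumes "graph_order G \<ge> 2"
    and dom: "ds_dominating (graph_join G H) S" and sub: "S \<subseteq> Inl ` pverts G"
    and card: "card S \<le> k"
  shows "ds_number G \<le> k"
proof -
  have "card (Inl -` S) = card S"
    using sub by (intro card_vimage_inj) auto
  then show ?thesis
    using ds_dominating_of_join_Inl[OF dom sub] card ds_number_le_iff[OF assms(1)] by metis
qed

lemma ds_number_join_le_3_of_left:
  assumes G: "pair_graph G" and H: "pair_graph H"
    and m: "graph_order G \<ge> 2" and n: "graph_order H \<ge> 2"
    and small: "ds_number G \<le> 3 \<or> graph_order G \<le> max_degree G + 2"
  shows "ds_number (graph_join G H) \<le> 3"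
proof -
  have "\<exists>S. ds_dominating (graph_join G H) S \<and> card S \<le> 3"
    using small
  proof
    assume "ds_number G \<le> 3"
    then obtain S where "ds_dominating G S" "card S \<le> 3"
      using ds_number_le_iff[OF m] by blast
    then show ?thesis
      using ds_dominating_join_Inl by (metis card_image inj_Inl)
  next
    assume "graph_order G \<le> max_degree G + 2"
    then obtain v w where v: "v \<in> pverts G" and w: "w \<in> pverts G" and "v \<noteq> w"
      and adj: "\<forall>u \<in> pverts G - {v, w}. (u, v) \<in> parcs G"
      using max_degree_ge_order_minus_2_iff[OF G m] by blast
    obtain h where h: "h \<in> pverts H"
      using n unfolding graph_order_def by fastforce
    let ?S = "{Inl v, Inl w, Inr h}"
    have "ds_dominating (graph_join G H) ?S"
      using v w h adj \<open>v \<noteq> w\<close> by (intro ds_dominatingI[of "{Inl v}" "{Inl w, Inr h}"]) auto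
    moreover have "card ?S \<le> 3"
      by (simp add: card_insert_if)
    ultimately show ?thesis
      by blast
  qed
  then show ?thesis
    using assms by (subst ds_number_le_iff) (auto simp: graph_order_join)
qed

text \<open>
  The case of a small DS-dominating set that meets both sides and has a singleton block on the
  left. Which of the two blocks is the singleton is immaterial, so only the domination by that
  block is assumed.
\<close>

lemma max_degree_ge_of_join_singleton_block:
  assumes G: "pair_graph G" and m: "graph_order G \<ge> 2"
    and S: "finite S" "card S \<le> 3" "Inl x \<in> S" "Inr y \<in> S"
    and x: "x \<in> pverts G"
    and dom: "\<forall>v \<in> pverts (graph_join G H) - S. (v, Inl x) \<in> parcs (graph_join G H)"
  shows "graph_order G \<le> max_degree G + 2"
proof -
  let ?T = "S - {Inl x, Inr y}"
  have "card ?T = card S - card {Inl x :: 'a + 'b, Inr y}"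
    using S(3,4) by (intro card_Diff_subset) auto
  with S(2) have "card ?T \<le> Suc 0"
    by simp
  with S(1) have T: "a = b" if "a \<in> ?T" "b \<in> ?T" for a b
    using that by (subst (asm) card_le_Suc0_iff_eq) (rule finite_Diff, assumption, blast)
  \<comment> \<open>Besides x, at most one vertex of G can belong to S; if none does, w is arbitrary.\<close>
  have "pverts G \<noteq> {x}"
    using m unfolding graph_order_def by auto
  with x obtain w where w: "w \<in> pverts G" "x \<noteq> w"
    and only: "\<forall>u \<in> pverts G - {x, w}. Inl u \<notin> S"
  proof (cases "\<exists>w \<in> pverts G. x \<noteq> w \<and> Inl w \<in> S")
    case True
    then obtain w where "w \<in> pverts G" "x \<noteq> w" "Inl w \<in> S"
      by blast
    with T[of "Inl w"] show ?thesis
      by (intro that[of w]) auto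
  next
    case False
    moreover obtain w where "w \<in> pverts G" "x \<noteq> w"
      using \<open>pverts G \<noteq> {x}\<close> x by blast
    ultimately show ?thesis
      by (intro that[of w]) auto
  qed
  have "(u, x) \<in> parcs G" if "u \<in> pverts G - {x, w}" for u
  proof -
    have "Inl u \<in> pverts (graph_join G H) - S"
      using that only by (simp add: InlI)
    from bspec[OF dom this] show ?thesis
      by simp
  qed
  then show ?thesis
    using max_degree_ge_order_minus_2_iff[OF G m] x w by blast
qed

lemma ds_number_join_le_3_iff:
  assumes G: "pair_graph G" and H: "pair_graph H"
    and m: "graph_order G \<ge> 2" and n: "graph_order H \<ge> 2"
  shows "ds_number (graph_join G H) \<le> 3 \<longleftrightarrow>
    (ds_number G \<le> 3 \<or> graph_order G \<le> max_degree G + 2) \<or>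
    (ds_number H \<le> 3 \<or> graph_order H \<le> max_degree H + 2)"
proof
  let ?J = "graph_join G H"
  assume "ds_number ?J \<le> 3"
  then obtain S where S: "ds_dominating ?J S" "card S \<le> 3"
    using assms by (subst (asm) ds_number_le_iff) (auto simp: graph_order_join)
  then obtain R B where SV: "S \<subseteq> pverts ?J"
    and RB: "R \<noteq> {}" "B \<noteq> {}" "R \<inter> B = {}" "R \<union> B = S"
    and dom: "\<forall>v \<in> pverts ?J - S.
      (\<exists>r \<in> R. (v, r) \<in> parcs ?J) \<and> (\<exists>b \<in> B. (v, b) \<in> parcs ?J)"
    unfolding ds_dominating_iff by blast
  interpret J: pair_graph ?J
    by (rule pair_graph_graph_join[OF G H])
  have fin: "finite S"
    using SV J.pair_finite_verts by (rule finite_subset)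
  consider "S \<subseteq> Inl ` pverts G" | "S \<subseteq> Inr ` pverts H"
    | g h where "Inl g \<in> S" "Inr h \<in> S"
    using SV by (fastforce simp: Plus_def)
  then show "(ds_number G \<le> 3 \<or> graph_order G \<le> max_degree G + 2) \<or>
    (ds_number H \<le> 3 \<or> graph_order H \<le> max_degree H + 2)"
  proof cases
    case 1
    with ds_number_le_of_join_Inl[OF m S(1)] S(2) show ?thesis
      by blast
  next
    case 2
    \<comment> \<open>Swapping the two sides leads back to sets on the left.\<close>
    let ?\<sigma> = "case_sum Inr Inl :: 'a + 'b \<Rightarrow> 'b + 'a"
    have "card (?\<sigma> ` S) \<le> 3"
      using card_image_le[OF fin] S(2) by (rule order_trans)
    moreover have "?\<sigma> ` S \<subseteq> Inl ` pverts H"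
      using 2 by auto
    ultimately show ?thesis
      using ds_number_le_of_join_Inl[OF n ds_dominating_join_swap[OF S(1)]] by blast
  next
    case (3 g h)
    have fins: "finite R" "finite B"
      using fin RB(4) by auto
    have "card R + card B \<le> 3"
      using S(2) card_Un_disjoint[OF fins RB(3)] RB(4) by simp
    moreover have "card R > 0" "card B > 0"
      using fins RB(1,2) by (auto simp: card_gt_0_iff)
    ultimately have "card R = 1 \<or> card B = 1"
      by linarith
    \<comment> \<open>The element z of a singleton block dominates every vertex outside S.\<close>
    then obtain z where z: "z \<in> S" "\<forall>v \<in> pverts ?J - S. (v, z) \<in> parcs ?J"
      using dom RB(4) by (auto simp: card_1_singleton_iff)
    show ?thesis
    proof (cases z)
      case (Inl x)
      with SV z have "x \<in> pverts G"
        by auto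
      with max_degree_ge_of_join_singleton_block[OF G m fin S(2)] z Inl 3 show ?thesis
        by blast
    next
      case (Inr x)
      \<comment> \<open>Again the situation is transferred to the join with its sides swapped.\<close>
      let ?\<sigma> = "case_sum Inr Inl :: 'a + 'b \<Rightarrow> 'b + 'a"
      have "card (?\<sigma> ` S) \<le> 3"
        using card_image_le[OF fin] S(2) by (rule order_trans)
      moreover have "Inl x \<in> ?\<sigma> ` S" "Inr g \<in> ?\<sigma> ` S"
        using z(1) Inr 3 by force+
      moreover have x: "x \<in> pverts H"
        using SV z(1) Inr by auto
      moreover have "\<forall>v \<in> pverts (graph_join H G) - ?\<sigma> ` S.
          (v, Inl x) \<in> parcs (graph_join H G)"
      proof
        fix v
        assume v: "v \<in> pverts (graph_join H G) - ?\<sigma> ` S"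
        then have "case_sum Inr Inl v \<in> pverts ?J - S"
          by (cases v) (force simp: image_iff)+
        with z(2) Inr have "(case_sum Inr Inl v, Inr x) \<in> parcs ?J"
          by blast
        then show "(v, Inl x) \<in> parcs (graph_join H G)"
          by (cases v) auto
      qed
      ultimately have "graph_order H \<le> max_degree H + 2"
        by (rule max_degree_ge_of_join_singleton_block[OF H n finite_imageI[OF fin]])
      then show ?thesis
        by blast
    qed
  qed
next
  assume "(ds_number G \<le> 3 \<or> graph_order G \<le> max_degree G + 2) \<or>
    (ds_number H \<le> 3 \<or> graph_order H \<le> max_degree H + 2)"
  then show "ds_number (graph_join G H) \<le> 3"
    using ds_number_join_le_3_of_left[OF G H m n] ds_number_join_le_3_of_left[OF H G n m]
      ds_number_join_commute[of G H] by auto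
qed

theorem theorem3p3:
  fixes G :: "'a pair_pre_digraph" and H :: "'b pair_pre_digraph" and m n :: nat
  assumes "pair_graph G" and "pair_graph H"
    and "graph_order G = m" and "m \<ge> 2"
    and "graph_order H = n" and "n \<ge> 2"
  shows "ds_number (graph_join G H) = 4 \<longleftrightarrow>
    (ds_number G \<ge> 4 \<and> ds_number H \<ge> 4) \<and>
    (int (max_degree G) \<le> int m - 3 \<and> int (max_degree H) \<le> int n - 3)"
proof -
  have "ds_number (graph_join G H) \<le> 4"
    using assms by (simp add: ds_number_join_le_4)
  then have "ds_number (graph_join G H) = 4 \<longleftrightarrow> \<not> ds_number (graph_join G H) \<le> 3"
    by linarith
  also have "\<dots> \<longleftrightarrow> \<not> ((ds_number G \<le> 3 \<or> m \<le> max_degree G + 2) \<or>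
      (ds_number H \<le> 3 \<or> n \<le> max_degree H + 2))"
    using assms by (subst ds_number_join_le_3_iff) auto
  finally show ?thesis
    by linarith
qed

end
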